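(* Let $\mathcal M$ be a Riemannian manifold with Levi-Civita connection $\nabla$ and let $p\ge1$. For any smooth tensor field $A$ and smooth vector fields $X_1,\dots,X_p$ on $\mathcal M$, $$\nabla_{X_p}\nabla_{X_{p-1}}\cdots\nabla_{X_1}A=\sum_{k=1}^p\nabla^kA\circ B^{\nabla}_{p,k}(X_1,\dots,X_p),$$ that is, the right-hand side is $\sum_{k=1}^p\ \sum_{(\mathsf B_1,\dots,\mathsf B_k)\in\mathcal{OP}(p,k)}\nabla^kA\left(X_{\mathsf B_1},\dots,X_{\mathsf B_k}\right)$.
   Context: $\mathcal{OP}(p,k)$ is the set of ordered $k$-partitions of $[p]=\{1,\dots,p\}$: $k$-tuples $(\mathsf B_1,\dots,\mathsf B_k)$ of non-empty sets partitioning $[p]$, each block written in increasing order $\mathsf B_i=\{\mathsf B_{i,1}<\dots<\mathsf B_{i,|\mathsf B_i|}\}$, with $\min\mathsf B_1<\dots<\min\mathsf B_k$. For a block, $X_{\mathsf B_i}=\nabla_{X_{\mathsf B_{i,|\mathsf B_i|}}}\cdots\nabla_{X_{\mathsf B_{i,2}}}X_{\mathsf B_{i,1}}$. The $(p,k)$-partial non-commutative Bell tuple is the formal sum $B^\nabla_{p,k}(X_1,\dots,X_p)=\sum_{\mathsf B\in\mathcal{OP}(p,k)}(X_{\mathsf B_1},\dots,X_{\mathsf B_k})$. The iterated covariant derivative $\nabla^kA$ takes $k$ vector-field arguments (and returns a tensor field of the same type as $A$), with the newest differentiation direction placed last: $\nabla A(Y)=\nabla_YA$ and $\nabla^{k+1}A(Y_1,\dots,Y_{k+1})=\nabla_{Y_{k+1}}[\nabla^kA(Y_1,\dots,Y_k)]-\sum_{i=1}^k\nabla^kA(Y_1,\dots,\nabla_{Y_{k+1}}Y_i,\dots,Y_k)$.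 *)

theory Defs
  imports "HOL-Analysis.Analysis" "HOL-Library.Function_Algebras"
begin

text \<open>Addition, subtraction, multiplication, zero and finite sums of functions are the pointwise
  ones of \<^theory>\<open>HOL-Library.Function_Algebras\<close>.\<close>

subsection \<open>Smooth manifolds\<close>

text \<open>The dimension is a natural number, so the model space is the topology
  \<^const>\<open>Euclidean_space\<close>, whose points are the sequences vanishing from index \<open>n\<close> on.
  Dimension 0 is allowed. \<open>Ck_on n k U f\<close> says that all partial derivatives of \<open>f\<close> of order at most
  \<open>k\<close> exist and are continuous on \<open>U\<close>; it is meant for \<open>U\<close> open in \<open>Euclidean_space n\<close> and does not
  depend on the values of \<open>f\<close> outside \<open>U\<close>.\<close>

definition partial :: "nat \<Rightarrow> ((nat \<Rightarrow> real) \<Rightarrow> real) \<Rightarrow> (nat \<Rightarrow> real) \<Rightarrow> real" where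
  "partial i f x = deriv (\<lambda>t. f (x(i := t))) (x i)"

primrec Ck_on :: "nat \<Rightarrow> nat \<Rightarrow> (nat \<Rightarrow> real) set \<Rightarrow> ((nat \<Rightarrow> real) \<Rightarrow> real) \<Rightarrow> bool" where
  "Ck_on n 0 U f \<longleftrightarrow> continuous_on U f"
| "Ck_on n (Suc k) U f \<longleftrightarrow> continuous_on U f \<and>
     (\<forall>i<n. (\<forall>x\<in>U. (\<lambda>t. f (x(i := t))) field_differentiable at (x i)) \<and>
            Ck_on n k U (partial i f))"

definition smooth_on :: "nat \<Rightarrow> (nat \<Rightarrow> real) set \<Rightarrow> ((nat \<Rightarrow> real) \<Rightarrow> real) \<Rightarrow> bool" where
  "smooth_on n U f \<longleftrightarrow> (\<forall>k. Ck_on n k U f)"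

record 'a manifold =
  mfd_dim :: nat
  mfd_top :: "'a topology"
  mfd_atlas :: "('a set \<times> ('a \<Rightarrow> nat \<Rightarrow> real)) set"

abbreviation points :: "'a manifold \<Rightarrow> 'a set" where
  "points M \<equiv> topspace (mfd_top M)"

definition is_chart :: "'a manifold \<Rightarrow> 'a set \<Rightarrow> ('a \<Rightarrow> nat \<Rightarrow> real) \<Rightarrow> bool" where
  "is_chart M U \<phi> \<longleftrightarrow>
     openin (mfd_top M) U \<and> openin (Euclidean_space (mfd_dim M)) (\<phi> ` U) \<and>
     homeomorphic_map (subtopology (mfd_top M) U)
       (subtopology (Euclidean_space (mfd_dim M)) (\<phi> ` U)) \<phi>"

definition smooth_manifold :: "'a manifold \<Rightarrow> bool" where
  "smooth_manifold M \<longleftrightarrow>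
     Hausdorff_space (mfd_top M) \<and> second_countable (mfd_top M) \<and>
     (\<forall>(U, \<phi>)\<in>mfd_atlas M. is_chart M U \<phi>) \<and>
     (\<Union>(U, \<phi>)\<in>mfd_atlas M. U) = points M \<and>
     (\<forall>(U, \<phi>)\<in>mfd_atlas M. \<forall>(V, \<psi>)\<in>mfd_atlas M. \<forall>i<mfd_dim M.
        smooth_on (mfd_dim M) (\<phi> ` (U \<inter> V)) (\<lambda>x. \<psi> (inv_into U \<phi> x) i))"

text \<open>The ring of smooth functions. A function on the manifold is represented by its extension by
  0 to the whole type, so that equality of functions on the manifold is equality in HOL. The same
  convention is used below for vector fields, one-forms and tensor fields: each takes the value 0
  at arguments outside its mathematical domain.\<close>

definition smooth_functions :: "'a manifold \<Rightarrow> ('a \<Rightarrow> real) set" where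
  "smooth_functions M = {f. (\<forall>q. q \<notin> points M \<longrightarrow> f q = 0) \<and>
     (\<forall>(U, \<phi>)\<in>mfd_atlas M. smooth_on (mfd_dim M) (\<phi> ` U) (\<lambda>x. f (inv_into U \<phi> x)))}"

subsection \<open>Vector fields\<close>

type_synonym 'a tangent = "('a \<Rightarrow> real) \<Rightarrow> real"
type_synonym 'a vfield = "'a \<Rightarrow> 'a tangent"

text \<open>Tangent vectors at \<open>q\<close> are the derivations at \<open>q\<close> of the ring of smooth functions.\<close>

definition tangent_space :: "'a manifold \<Rightarrow> 'a \<Rightarrow> 'a tangent set" where
  "tangent_space M q = {v.
     (\<forall>f. f \<notin> smooth_functions M \<longrightarrow> v f = 0) \<and>
     (\<forall>f\<in>smooth_functions M. \<forall>h\<in>smooth_functions M. \<forall>a b.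
        v (\<lambda>x. a * f x + b * h x) = a * v f + b * v h) \<and>
     (\<forall>f\<in>smooth_functions M. \<forall>h\<in>smooth_functions M. v (f * h) = v f * h q + f q * v h)}"

definition vf_apply :: "'a vfield \<Rightarrow> ('a \<Rightarrow> real) \<Rightarrow> 'a \<Rightarrow> real" where
  "vf_apply Y f = (\<lambda>q. Y q f)"

definition vector_fields :: "'a manifold \<Rightarrow> 'a vfield set" where
  "vector_fields M = {Y.
     (\<forall>q. q \<notin> points M \<longrightarrow> Y q = 0) \<and>
     (\<forall>q\<in>points M. Y q \<in> tangent_space M q) \<and>
     (\<forall>f\<in>smooth_functions M. vf_apply Y f \<in> smooth_functions M)}"

definition vf_scale :: "('a \<Rightarrow> real) \<Rightarrow> 'a vfield \<Rightarrow> 'a vfield" where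
  "vf_scale f Y = (\<lambda>q h. f q * Y q h)"

definition lie_bracket :: "'a vfield \<Rightarrow> 'a vfield \<Rightarrow> 'a vfield" where
  "lie_bracket Y Z = (\<lambda>q f. Y q (vf_apply Z f) - Z q (vf_apply Y f))"

subsection \<open>Riemannian metrics and the Levi-Civita connection\<close>

type_synonym 'a metric_field = "'a \<Rightarrow> 'a tangent \<Rightarrow> 'a tangent \<Rightarrow> real"

definition metric_apply :: "'a metric_field \<Rightarrow> 'a vfield \<Rightarrow> 'a vfield \<Rightarrow> 'a \<Rightarrow> real" where
  "metric_apply g Y Z = (\<lambda>q. g q (Y q) (Z q))"

definition riemannian_metric :: "'a manifold \<Rightarrow> 'a metric_field \<Rightarrow> bool" where
  "riemannian_metric M g \<longleftrightarrow>
     (\<forall>q. q \<notin> points M \<longrightarrow> g q = 0) \<and>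
     (\<forall>q\<in>points M. \<forall>u\<in>tangent_space M q. \<forall>v\<in>tangent_space M q.
        g q u v = g q v u \<and>
        (\<forall>w\<in>tangent_space M q. \<forall>a b. g q (\<lambda>f. a * u f + b * v f) w = a * g q u w + b * g q v w) \<and>
        (u \<noteq> 0 \<longrightarrow> g q u u > 0)) \<and>
     (\<forall>Y\<in>vector_fields M. \<forall>Z\<in>vector_fields M. metric_apply g Y Z \<in> smooth_functions M)"

definition riemannian_manifold :: "'a manifold \<Rightarrow> 'a metric_field \<Rightarrow> bool" where
  "riemannian_manifold M g \<longleftrightarrow> smooth_manifold M \<and> riemannian_metric M g"

text \<open>\<open>D Y Z\<close> is the covariant derivative of the vector field \<open>Z\<close> in the direction \<open>Y\<close>.\<close>

type_synonym 'a connection = "'a vfield \<Rightarrow> 'a vfield \<Rightarrow> 'a vfield"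

definition affine_connection :: "'a manifold \<Rightarrow> 'a connection \<Rightarrow> bool" where
  "affine_connection M D \<longleftrightarrow>
     (\<forall>Y\<in>vector_fields M. \<forall>Z\<in>vector_fields M. D Y Z \<in> vector_fields M) \<and>
     (\<forall>Y\<in>vector_fields M. \<forall>Y'\<in>vector_fields M. \<forall>Z\<in>vector_fields M.
      \<forall>f\<in>smooth_functions M. \<forall>h\<in>smooth_functions M.
        D (vf_scale f Y + vf_scale h Y') Z = vf_scale f (D Y Z) + vf_scale h (D Y' Z)) \<and>
     (\<forall>Y\<in>vector_fields M. \<forall>Z\<in>vector_fields M. \<forall>Z'\<in>vector_fields M. \<forall>a b.
        D Y (vf_scale (\<lambda>_. a) Z + vf_scale (\<lambda>_. b) Z')
          = vf_scale (\<lambda>_. a) (D Y Z) + vf_scale (\<lambda>_. b) (D Y Z')) \<and>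
     (\<forall>Y\<in>vector_fields M. \<forall>Z\<in>vector_fields M. \<forall>f\<in>smooth_functions M.
        D Y (vf_scale f Z) = vf_scale (vf_apply Y f) Z + vf_scale f (D Y Z))"

definition levi_civita :: "'a manifold \<Rightarrow> 'a metric_field \<Rightarrow> 'a connection \<Rightarrow> bool" where
  "levi_civita M g D \<longleftrightarrow> affine_connection M D \<and>
     (\<forall>Y\<in>vector_fields M. \<forall>Z\<in>vector_fields M. D Y Z - D Z Y = lie_bracket Y Z) \<and>
     (\<forall>Y\<in>vector_fields M. \<forall>Z\<in>vector_fields M. \<forall>W\<in>vector_fields M.
        vf_apply Y (metric_apply g Z W) = metric_apply g (D Y Z) W + metric_apply g Z (D Y W))"

subsection \<open>Tensor fields and their covariant derivatives\<close>

text \<open>One-forms are the elements of the dual of the module of vector fields over the ring of smooth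
  functions; a tensor field of type \<open>(r, s)\<close> is a map of \<open>r\<close> one-forms and \<open>s\<close> vector fields to
  smooth functions that is linear over this ring in each argument.\<close>

type_synonym 'a one_form = "'a vfield \<Rightarrow> 'a \<Rightarrow> real"
type_synonym 'a tensor = "'a one_form list \<Rightarrow> 'a vfield list \<Rightarrow> 'a \<Rightarrow> real"

definition one_forms :: "'a manifold \<Rightarrow> 'a one_form set" where
  "one_forms M = {\<omega>.
     (\<forall>Y. Y \<notin> vector_fields M \<longrightarrow> \<omega> Y = 0) \<and>
     (\<forall>Y\<in>vector_fields M. \<omega> Y \<in> smooth_functions M) \<and>
     (\<forall>Y\<in>vector_fields M. \<forall>Z\<in>vector_fields M.
      \<forall>f\<in>smooth_functions M. \<forall>h\<in>smooth_functions M.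
        \<omega> (vf_scale f Y + vf_scale h Z) = f * \<omega> Y + h * \<omega> Z)}"

definition form_scale :: "('a \<Rightarrow> real) \<Rightarrow> 'a one_form \<Rightarrow> 'a one_form" where
  "form_scale f \<omega> = (\<lambda>Y. f * \<omega> Y)"

definition tensor_fields :: "'a manifold \<Rightarrow> nat \<Rightarrow> nat \<Rightarrow> 'a tensor set" where
  "tensor_fields M r s = {A. \<forall>\<omega>s Ys.
     (if length \<omega>s = r \<and> set \<omega>s \<subseteq> one_forms M \<and> length Ys = s \<and> set Ys \<subseteq> vector_fields M
      then
        A \<omega>s Ys \<in> smooth_functions M \<and>
        (\<forall>j<r. \<forall>\<alpha>\<in>one_forms M. \<forall>\<beta>\<in>one_forms M. \<forall>f\<in>smooth_functions M. \<forall>h\<in>smooth_functions M.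
           A (\<omega>s[j := form_scale f \<alpha> + form_scale h \<beta>]) Ys
             = f * A (\<omega>s[j := \<alpha>]) Ys + h * A (\<omega>s[j := \<beta>]) Ys) \<and>
        (\<forall>i<s. \<forall>Y\<in>vector_fields M. \<forall>Z\<in>vector_fields M.
         \<forall>f\<in>smooth_functions M. \<forall>h\<in>smooth_functions M.
           A \<omega>s (Ys[i := vf_scale f Y + vf_scale h Z])
             = f * A \<omega>s (Ys[i := Y]) + h * A \<omega>s (Ys[i := Z]))
      else A \<omega>s Ys = 0)}"

definition cov_form :: "'a manifold \<Rightarrow> 'a connection \<Rightarrow> 'a vfield \<Rightarrow> 'a one_form \<Rightarrow> 'a one_form" where
  "cov_form M D Y \<omega> =
     (\<lambda>Z. if Z \<in> vector_fields M then vf_apply Y (\<omega> Z) - \<omega> (D Y Z) else 0)"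

text \<open>The extension of a connection to tensor fields of every type by the product rule.\<close>

definition cov_tensor :: "'a manifold \<Rightarrow> 'a connection \<Rightarrow> 'a vfield \<Rightarrow> 'a tensor \<Rightarrow> 'a tensor" where
  "cov_tensor M D Y A = (\<lambda>\<omega>s Zs.
     if set \<omega>s \<subseteq> one_forms M \<and> set Zs \<subseteq> vector_fields M then
       vf_apply Y (A \<omega>s Zs)
       - (\<Sum>j<length \<omega>s. A (\<omega>s[j := cov_form M D Y (\<omega>s ! j)]) Zs)
       - (\<Sum>i<length Zs. A \<omega>s (Zs[i := D Y (Zs ! i)]))
     else 0)"

text \<open>\<open>iter_cov M D k A Ys\<close> is the \<open>k\<close>-th iterated covariant derivative of \<open>A\<close> evaluated at the \<open>k\<close>
  directions \<open>Ys\<close>, the newest direction being the last entry of \<open>Ys\<close>.\<close>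

primrec iter_cov ::
  "'a manifold \<Rightarrow> 'a connection \<Rightarrow> nat \<Rightarrow> 'a tensor \<Rightarrow> 'a vfield list \<Rightarrow> 'a tensor" where
  "iter_cov M D 0 A Ys = A"
| "iter_cov M D (Suc k) A Ys =
     cov_tensor M D (Ys ! k) (iter_cov M D k A (take k Ys))
     - (\<Sum>i<k. iter_cov M D k A ((take k Ys)[i := D (Ys ! k) (Ys ! i)]))"

subsection \<open>Ordered partitions and blocks\<close>

definition ordered_partitions :: "nat \<Rightarrow> nat \<Rightarrow> nat set list set" where
  "ordered_partitions p k = {Bs. length Bs = k \<and> partition_on {1..p} (set Bs) \<and>
     sorted_wrt (\<lambda>B C. Min B < Min C) Bs}"

text \<open>For a block with elements \<open>b\<^sub>1 < \<dots> < b\<^sub>m\<close>: start from \<open>X b\<^sub>1\<close> and differentiate successively in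
  the directions \<open>X b\<^sub>2, \<dots>, X b\<^sub>m\<close>.\<close>

definition block_field :: "'a connection \<Rightarrow> (nat \<Rightarrow> 'a vfield) \<Rightarrow> nat set \<Rightarrow> 'a vfield" where
  "block_field D X B = (let bs = sorted_list_of_set B in
     fold (\<lambda>b Z. D (X b) Z) (tl bs) (X (hd bs)))"

end

theory Submission
  imports Defs
begin

text \<open>Since \<open>iter_cov\<close> is defined by the product rule, differentiating
  \<open>\<nabla>\<^sup>kA(X\<^bsub>B\<^sub>1\<^esub>, \<dots>, X\<^bsub>B\<^sub>k\<^esub>)\<close> in the direction \<open>X\<^bsub>p+1\<^esub>\<close> either appends the new argument
  \<open>X\<^bsub>p+1\<^esub>\<close> or differentiates one of the old arguments. Combinatorially, an ordered partition of
  \<open>{1..p+1}\<close> arises from one of \<open>{1..p}\<close> by either appending the block \<open>{p+1}\<close> (whose minimum is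
  largest, so it comes last) or inserting \<open>p+1\<close> into one of the blocks (which leaves the minima
  unchanged). The two recursions agree, and the formula follows by induction starting at \<open>p = 0\<close>.
  Tangent vectors vanish on non-smooth functions, so additivity of \<open>cov_tensor\<close> in the tensor needs
  all tensors in sight to have smooth values.\<close>

subsection \<open>Linearity of smooth functions\<close>

text \<open>As i < n, changing coordinate i keeps all coordinates from n on at 0, so only the open
  set \<open>T\<close> with trace \<open>U\<close> restricts t, and its preimage under t -> x(i :=
  t) is open. Thus a partial derivative at a point of \<open>U\<close> depends only on values in
  \<open>U\<close>.\<close>

lemma eventually_update_in_openin_Euclidean_space:
  assumes "openin (Euclidean_space n) U" "x \<in> U" "i < n"
  shows "\<forall>\<^sub>F t in nhds (x i). x(i := t) \<in> U"
proof -
  obtain T where T: "open T" "U = T \<inter> {x. \<forall>i\<ge>n. x i = 0}"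
    using assms(1)
    by (auto simp: Euclidean_space_def openin_subtopology euclidean_product_topology)
  have "continuous_on UNIV (\<lambda>t. x(i := t))"
  proof (rule continuous_on_coordinatewise_then_product)
    show "continuous_on UNIV (\<lambda>t. (x(i := t)) j)" for j
      by (cases "j = i") auto
  qed
  then have "open ((\<lambda>t. x(i := t)) -` T)"
    using T(1) continuous_on_open_vimage[of UNIV] by auto
  moreover have "x i \<in> (\<lambda>t. x(i := t)) -` T"
    using T assms(2) by auto
  ultimately have "\<forall>\<^sub>F t in nhds (x i). t \<in> (\<lambda>t. x(i := t)) -` T"
    by (rule eventually_nhds_in_open)
  then show ?thesis
    by eventually_elim (use T assms in auto)
qed

text \<open>Partial derivatives are local, so agreement on the open set \<open>U\<close> passes from
  functions to their partials and the induction goes through. This serves identities between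
  partials that are known on \<open>U\<close> only.\<close>

lemma Ck_on_cong:
  assumes "openin (Euclidean_space n) U" "Ck_on n k U f" "\<And>x. x \<in> U \<Longrightarrow> f x = h x"
  shows "Ck_on n k U h"
  using assms(2,3)
proof (induction k arbitrary: f h)
  case 0
  then show ?case by (auto cong: continuous_on_cong)
next
  case (Suc k)
  have ev: "\<forall>\<^sub>F t in nhds (x i). f (x(i := t)) = h (x(i := t))" if "x \<in> U" "i < n" for x i
    using eventually_update_in_openin_Euclidean_space[OF assms(1) that]
    by eventually_elim (use Suc.prems(2) in auto)
  have "Ck_on n k U (partial i h)" if "i < n" for i
  proof (rule Suc.IH)
    show "Ck_on n k U (partial i f)" using Suc.prems(1) that by simp
    show "partial i f x = partial i h x" if "x \<in> U" for x
      unfolding partial_def by (rule deriv_cong_ev[OF ev]) (use that \<open>i < n\<close> in auto)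
  qed
  moreover have "(\<lambda>t. h (x(i := t))) field_differentiable at (x i)" if "x \<in> U" "i < n" for x i
  proof -
    have "(\<lambda>t. f (x(i := t))) field_differentiable at (x i)"
      using Suc.prems(1) that by simp
    then obtain d where "((\<lambda>t. f (x(i := t))) has_field_derivative d) (at (x i))"
      by (auto simp: field_differentiable_def)
    then have "((\<lambda>t. h (x(i := t))) has_field_derivative d) (at (x i))"
      using DERIV_cong_ev[OF refl ev[OF that] refl] by blast
    then show ?thesis by (auto simp: field_differentiable_def)
  qed
  moreover have "continuous_on U h"
    using Suc.prems by (auto cong: continuous_on_cong)
  ultimately show ?case by simp
qed

lemma Ck_on_const: "Ck_on n k U (\<lambda>_. c)"
proof (induction k arbitrary: c)
  case (Suc k)
  have "partial i (\<lambda>_. c) = (\<lambda>_. 0)" for i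
    by (simp add: partial_def fun_eq_iff)
  then show ?case using Suc by simp
qed simp

lemma Ck_on_linear:
  assumes "openin (Euclidean_space n) U" "Ck_on n k U f" "Ck_on n k U h"
  shows "Ck_on n k U (\<lambda>x. a * f x + b * h x)"
  using assms(2,3)
proof (induction k arbitrary: f h)
  case 0
  then show ?case by (auto intro!: continuous_intros)
next
  case (Suc k)
  \<comment> \<open>Off \<open>U\<close> differentiability is unknown and \<open>deriv\<close> need
    not be additive, so the equality of partials is claimed on \<open>U\<close> only.\<close>
  have "Ck_on n k U (partial i (\<lambda>x. a * f x + b * h x))" if "i < n" for i
  proof (rule Ck_on_cong[OF assms(1)])
    show "Ck_on n k U (\<lambda>x. a * partial i f x + b * partial i h x)"
      using Suc that by simp
    fix x assume "x \<in> U"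
    then have "(\<lambda>t. f (x(i := t))) field_differentiable at (x i)"
      "(\<lambda>t. h (x(i := t))) field_differentiable at (x i)"
      using Suc.prems that by auto
    then show "a * partial i f x + b * partial i h x = partial i (\<lambda>x. a * f x + b * h x) x"
      by (simp add: partial_def field_differentiable_mult deriv_cmult field_differentiable_const)
  qed
  then show ?case
    using Suc.prems
    by (auto intro!: continuous_intros field_differentiable_add field_differentiable_mult
        field_differentiable_const)
qed

lemma smooth_functions_linear:
  assumes "smooth_manifold M" "f \<in> smooth_functions M" "h \<in> smooth_functions M"
  shows "(\<lambda>x. a * f x + b * h x) \<in> smooth_functions M"
proof -
  have "openin (Euclidean_space (mfd_dim M)) (\<phi> ` U)" if "(U, \<phi>) \<in> mfd_atlas M" for U \<phi>
    using assms(1) that by (auto simp: smooth_manifold_def is_chart_def)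
  then show ?thesis
    using assms(2,3) by (fastforce simp: smooth_functions_def smooth_on_def intro!: Ck_on_linear)
qed

lemma smooth_functions_zero: "0 \<in> smooth_functions M"
  by (auto simp: smooth_functions_def smooth_on_def Ck_on_const)

lemma smooth_functions_add:
  assumes "smooth_manifold M" "f \<in> smooth_functions M" "h \<in> smooth_functions M"
  shows "f + h \<in> smooth_functions M"
  using smooth_functions_linear[OF assms, of 1 1] by (simp add: plus_fun_def)

lemma smooth_functions_diff:
  assumes "smooth_manifold M" "f \<in> smooth_functions M" "h \<in> smooth_functions M"
  shows "f - h \<in> smooth_functions M"
  using smooth_functions_linear[OF assms, of 1 "-1"] by (simp add: fun_diff_def)

lemma smooth_functions_sum:
  assumes "smooth_manifold M" "\<And>i. i \<in> I \<Longrightarrow> f i \<in> smooth_functions M"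
  shows "sum f I \<in> smooth_functions M"
  using assms(2)
  \<comment> \<open>An infinite index set gives the default sum 0, which is smooth.\<close>
  by (induction I rule: infinite_finite_induct)
    (auto intro: smooth_functions_zero smooth_functions_add assms(1))

section \<open>Additivity of vector fields on smooth functions\<close>

lemma vf_apply_zero:
  assumes "Y \<in> vector_fields M"
  shows "vf_apply Y 0 = 0"
proof
  fix q
  show "vf_apply Y 0 q = 0 q"
  proof (cases "q \<in> points M")
    case True
    then have "Y q \<in> tangent_space M q" using assms by (simp add: vector_fields_def)
    then have "\<forall>f\<in>smooth_functions M. \<forall>h\<in>smooth_functions M. \<forall>a b.
        Y q (\<lambda>x. a * f x + b * h x) = a * Y q f + b * Y q h"
      by (simp add: tangent_space_def)
    from this[rule_format, OF smooth_functions_zero smooth_functions_zero, of 0 0]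
    show ?thesis by (simp add: vf_apply_def zero_fun_def)
  qed (use assms in \<open>simp add: vector_fields_def vf_apply_def\<close>)
qed

lemma vf_apply_add:
  assumes "Y \<in> vector_fields M" "f \<in> smooth_functions M" "h \<in> smooth_functions M"
  shows "vf_apply Y (f + h) = vf_apply Y f + vf_apply Y h"
proof
  fix q
  show "vf_apply Y (f + h) q = (vf_apply Y f + vf_apply Y h) q"
  proof (cases "q \<in> points M")
    case True
    then have "Y q \<in> tangent_space M q" using assms by (simp add: vector_fields_def)
    then have "\<forall>f\<in>smooth_functions M. \<forall>h\<in>smooth_functions M. \<forall>a b.
        Y q (\<lambda>x. a * f x + b * h x) = a * Y q f + b * Y q h"
      by (simp add: tangent_space_def)
    from this[rule_format, OF assms(2,3), of 1 1]
    show ?thesis by (simp add: vf_apply_def plus_fun_def)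
  qed (use assms in \<open>simp add: vector_fields_def vf_apply_def\<close>)
qed

subsection \<open>Covariant derivatives of tensors with smooth values\<close>

text \<open>The invariant kept under \<open>cov_tensor\<close>, sums and differences. It ranges over
  all argument lists, including those of wrong length or with foreign entries, where tensor fields
  take the smooth value 0.\<close>

definition smooth_valued :: "'a manifold \<Rightarrow> 'a tensor \<Rightarrow> bool" where
  "smooth_valued M A \<longleftrightarrow> (\<forall>\<omega>s Zs. A \<omega>s Zs \<in> smooth_functions M)"

lemma smooth_valued_tensor_field:
  assumes "A \<in> tensor_fields M r s"
  shows "smooth_valued M A"
  unfolding smooth_valued_def
proof (intro allI)
  fix \<omega>s Zs
  have "A \<omega>s Zs \<in> smooth_functions M \<or> A \<omega>s Zs = 0"
    using assms unfolding tensor_fields_def mem_Collect_eq by meson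
  then show "A \<omega>s Zs \<in> smooth_functions M"
    using smooth_functions_zero by metis
qed

lemma smooth_valued_zero: "smooth_valued M 0"
  by (simp add: smooth_valued_def smooth_functions_zero)

lemma smooth_valued_add:
  "\<lbrakk>smooth_manifold M; smooth_valued M A; smooth_valued M B\<rbrakk> \<Longrightarrow> smooth_valued M (A + B)"
  by (simp add: smooth_valued_def smooth_functions_add)

lemma smooth_valued_diff:
  "\<lbrakk>smooth_manifold M; smooth_valued M A; smooth_valued M B\<rbrakk> \<Longrightarrow> smooth_valued M (A - B)"
  by (simp add: smooth_valued_def smooth_functions_diff)

lemma smooth_valued_sum:
  assumes "smooth_manifold M" "\<And>i. i \<in> I \<Longrightarrow> smooth_valued M (A i)"
  shows "smooth_valued M (sum A I)"
  using assms(2)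
  by (induction I rule: infinite_finite_induct)
    (auto intro: smooth_valued_zero smooth_valued_add assms(1))

text \<open>\<open>D\<close> is an arbitrary map here, so the updated lists may leave the domain of
  the tensor; the quantification over all lists in \<open>smooth_valued\<close> covers them.\<close>

lemma smooth_valued_cov_tensor:
  assumes "smooth_manifold M" "Y \<in> vector_fields M" "smooth_valued M A"
  shows "smooth_valued M (cov_tensor M D Y A)"
proof -
  have "vf_apply Y f \<in> smooth_functions M" if "f \<in> smooth_functions M" for f
    using assms(2) that by (simp add: vector_fields_def)
  then show ?thesis
    using assms(3) unfolding smooth_valued_def cov_tensor_def
    by (auto intro!: smooth_functions_diff smooth_functions_sum smooth_functions_zero assms(1))
qed

lemma cov_tensor_zero:
  assumes "Y \<in> vector_fields M"
  shows "cov_tensor M D Y 0 = 0"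
  using vf_apply_zero[OF assms] by (auto simp: cov_tensor_def fun_eq_iff)

lemma cov_tensor_add:
  assumes "Y \<in> vector_fields M" "smooth_valued M A" "smooth_valued M B"
  shows "cov_tensor M D Y (A + B) = cov_tensor M D Y A + cov_tensor M D Y B"
proof (intro ext)
  fix \<omega>s Zs q
  \<comment> \<open>The correction sums are additive in the tensor by pointwise addition; the
    leading term needs smooth arguments.\<close>
  have "vf_apply Y (A \<omega>s Zs + B \<omega>s Zs) = vf_apply Y (A \<omega>s Zs) + vf_apply Y (B \<omega>s Zs)"
    using assms by (intro vf_apply_add) (auto simp: smooth_valued_def)
  then show "cov_tensor M D Y (A + B) \<omega>s Zs q = (cov_tensor M D Y A + cov_tensor M D Y B) \<omega>s Zs q"
    by (simp add: cov_tensor_def sum.distrib)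
qed

lemma cov_tensor_sum:
  assumes "smooth_manifold M" "Y \<in> vector_fields M" "\<And>i. i \<in> I \<Longrightarrow> smooth_valued M (A i)"
  shows "cov_tensor M D Y (sum A I) = (\<Sum>i\<in>I. cov_tensor M D Y (A i))"
  using assms(3)
  by (induction I rule: infinite_finite_induct)
    (auto simp: cov_tensor_zero[OF assms(2)] cov_tensor_add[OF assms(2)]
      smooth_valued_sum[OF assms(1)])

lemma smooth_valued_iter_cov:
  assumes "smooth_manifold M" "affine_connection M D" "smooth_valued M A"
    "length Ys = k" "set Ys \<subseteq> vector_fields M"
  shows "smooth_valued M (iter_cov M D k A Ys)"
  using assms(4,5)
\<comment> \<open>\<open>Ys\<close> is generalized because the correction terms evaluate the lower
  derivative at altered lists of directions.\<close>
proof (induction k arbitrary: Ys)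
  case 0
  then show ?case using assms(3) by simp
next
  case (Suc k)
  have D: "D Y Z \<in> vector_fields M" if "Y \<in> vector_fields M" "Z \<in> vector_fields M" for Y Z
    using assms(2) that by (simp add: affine_connection_def)
  have nth: "Ys ! i \<in> vector_fields M" if "i \<le> k" for i
    using Suc.prems that by (metis le_imp_less_Suc nth_mem subsetD)
  have take: "set (take k Ys) \<subseteq> vector_fields M"
    using Suc.prems by (meson set_take_subset subset_trans)
  have "set ((take k Ys)[i := D (Ys ! k) (Ys ! i)]) \<subseteq> vector_fields M" if "i < k" for i
    using take D nth that by (intro set_update_subsetI) auto
  then show ?case
    using Suc.prems take nth unfolding iter_cov.simps
    by (intro smooth_valued_diff smooth_valued_sum smooth_valued_cov_tensor Suc.IH assms(1)) auto
qed

text \<open>The defining recursion at \<open>Ys @ [Y]\<close>, solved for its leading term. The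
  arguments differentiated in the correction sum sit below index k, so they are entries of
  \<open>Ys\<close>.\<close>

lemma cov_tensor_iter_cov:
  assumes "length Ys = k"
  shows "cov_tensor M D Y (iter_cov M D k A Ys)
    = iter_cov M D (Suc k) A (Ys @ [Y]) + (\<Sum>i<k. iter_cov M D k A (Ys[i := D Y (Ys ! i)]))"
proof -
  have "(\<Sum>i<k. iter_cov M D k A (Ys[i := D Y ((Ys @ [Y]) ! i)]))
      = (\<Sum>i<k. iter_cov M D k A (Ys[i := D Y (Ys ! i)]))"
    by (rule sum.cong) (use assms in \<open>auto simp: nth_append\<close>)
  moreover have "(Ys @ [Y]) ! k = Y" using assms by auto
  ultimately show ?thesis using assms by simp
qed

subsection \<open>Recursion for ordered partitions\<close>

text \<open>Strictly increasing minima make blocks at different positions distinct, so disjointness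
  of the set of blocks is the same as disjointness by position.\<close>

lemma ordered_partitions_iff_nth:
  "Bs \<in> ordered_partitions p k \<longleftrightarrow> length Bs = k \<and> (\<Union>i<k. Bs ! i) = {1..p} \<and>
     (\<forall>i<k. Bs ! i \<noteq> {}) \<and>
     (\<forall>i j. i < j \<longrightarrow> j < k \<longrightarrow> Bs ! i \<inter> Bs ! j = {} \<and> Min (Bs ! i) < Min (Bs ! j))"
proof (cases "length Bs = k")
  case True
  have U: "\<Union>(set Bs) = (\<Union>i<k. Bs ! i)"
    using True by (auto simp: set_conv_nth)
  have ne: "{} \<notin> set Bs \<longleftrightarrow> (\<forall>i<k. Bs ! i \<noteq> {})"
    using True by (auto simp: in_set_conv_nth)
  have dj: "disjoint (set Bs) \<longleftrightarrow> (\<forall>i j. i < j \<longrightarrow> j < k \<longrightarrow> Bs ! i \<inter> Bs ! j = {})"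
    if "\<forall>i j. i < j \<longrightarrow> j < k \<longrightarrow> Min (Bs ! i) < Min (Bs ! j)"
  proof
    assume d: "disjoint (set Bs)"
    show "\<forall>i j. i < j \<longrightarrow> j < k \<longrightarrow> Bs ! i \<inter> Bs ! j = {}"
    proof (intro allI impI)
      fix i j assume ij: "i < j" "j < k"
      with that have "Bs ! i \<noteq> Bs ! j" by (metis less_irrefl)
      with d ij True show "Bs ! i \<inter> Bs ! j = {}" by (auto simp: disjoint_def)
    qed
  next
    assume d: "\<forall>i j. i < j \<longrightarrow> j < k \<longrightarrow> Bs ! i \<inter> Bs ! j = {}"
    show "disjoint (set Bs)"
      unfolding disjoint_def
    proof (intro ballI impI)
      fix B C assume "B \<in> set Bs" "C \<in> set Bs" "B \<noteq> C"
      then obtain i j where "i < k" "B = Bs ! i" "j < k" "C = Bs ! j" "i \<noteq> j"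
        using True by (metis in_set_conv_nth)
      with d show "B \<inter> C = {}" by (metis Int_commute linorder_neqE_nat)
    qed
  qed
  show ?thesis
    using True dj
    by (auto simp: ordered_partitions_def partition_on_def U ne sorted_wrt_iff_nth_less)
qed (simp add: ordered_partitions_def)

lemma ordered_partitionsI:
  assumes "length Bs = k" "(\<Union>i<k. Bs ! i) = {1..p}" "\<And>i. i < k \<Longrightarrow> Bs ! i \<noteq> {}"
    "\<And>i j. i < j \<Longrightarrow> j < k \<Longrightarrow> Bs ! i \<inter> Bs ! j = {}"
    "\<And>i j. i < j \<Longrightarrow> j < k \<Longrightarrow> Min (Bs ! i) < Min (Bs ! j)"
  shows "Bs \<in> ordered_partitions p k"
  unfolding ordered_partitions_iff_nth using assms by blast

lemma ordered_partitionsD: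
  assumes "Bs \<in> ordered_partitions p k"
  shows "length Bs = k" "(\<Union>i<k. Bs ! i) = {1..p}"
    "\<And>i j. i < j \<Longrightarrow> j < k \<Longrightarrow> Bs ! i \<inter> Bs ! j = {}"
    "\<And>i j. i < j \<Longrightarrow> j < k \<Longrightarrow> Min (Bs ! i) < Min (Bs ! j)"
  using assms unfolding ordered_partitions_iff_nth by blast+

lemma finite_ordered_partitions: "finite (ordered_partitions p k)"
proof (rule finite_subset)
  show "ordered_partitions p k \<subseteq> {Bs. set Bs \<subseteq> Pow {1..p} \<and> length Bs = k}"
    by (auto simp: ordered_partitions_def partition_on_def)
qed (rule finite_lists_length_eq, simp)

lemma ordered_partitions_0_0: "ordered_partitions 0 0 = {[]}"
  by (auto simp: ordered_partitions_iff_nth)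

lemma ordered_partitions_Suc_0: "ordered_partitions (Suc p) 0 = {}"
  by (auto simp: ordered_partitions_iff_nth)

lemma ordered_partitions_block:
  assumes "Bs \<in> ordered_partitions p k" "i < k"
  shows "Bs ! i \<noteq> {}" "Bs ! i \<subseteq> {1..p}" "finite (Bs ! i)" "Min (Bs ! i) \<in> {1..p}"
proof -
  show "Bs ! i \<noteq> {}" "Bs ! i \<subseteq> {1..p}"
    using assms by (auto simp: ordered_partitions_iff_nth)
  then show "finite (Bs ! i)" using finite_subset by blast
  with \<open>Bs ! i \<noteq> {}\<close> \<open>Bs ! i \<subseteq> {1..p}\<close> show "Min (Bs ! i) \<in> {1..p}" using Min_in by blast
qed

text \<open>The block minima would be k distinct elements of {1..p}.\<close>

lemma ordered_partitions_eq_empty: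
  assumes "p < k"
  shows "ordered_partitions p k = {}"
proof -
  have False if Bs: "Bs \<in> ordered_partitions p k" for Bs
  proof -
    have "inj_on (\<lambda>i. Min (Bs ! i)) {..<k}"
      using ordered_partitionsD(4)[OF Bs]
      by (intro linorder_inj_onI) (metis lessThan_iff less_irrefl, auto)
    moreover have "(\<lambda>i. Min (Bs ! i)) ` {..<k} \<subseteq> {1..p}"
      using ordered_partitions_block(4)[OF Bs] by auto
    ultimately have "k \<le> p"
      using card_inj_on_le[of _ "{..<k}" "{1..p}"] by auto
    with assms show False by simp
  qed
  then show ?thesis by blast
qed

lemma Min_insert_Suc:
  assumes "finite B" "B \<noteq> {}" "B \<subseteq> {1..p}"
  shows "Min (insert (Suc p) B) = Min B"
proof -
  have "Min B \<le> Suc p" using assms Min_in by fastforce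
  then show ?thesis using assms by simp
qed

section \<open>The two ways of adding the element p+1\<close>

definition append_singleton :: "nat \<Rightarrow> nat set list \<Rightarrow> nat set list" where
  "append_singleton n Bs = Bs @ [{n}]"

text \<open>List and position form one argument so that this extension is a single map on a product
  set, ready for injectivity and for reindexing a double sum.\<close>

definition insert_at :: "nat \<Rightarrow> nat set list \<times> nat \<Rightarrow> nat set list" where
  "insert_at n = (\<lambda>(Bs, i). Bs[i := insert n (Bs ! i)])"

lemma append_singleton_in_ordered_partitions:
  assumes "Bs \<in> ordered_partitions p k"
  shows "append_singleton (Suc p) Bs \<in> ordered_partitions (Suc p) (Suc k)"
proof -
  have Min: "Min (Bs ! i) < Suc p" if "i < k" for i
    using ordered_partitions_block(4)[OF assms that] by simp
  have sub: "Suc p \<notin> Bs ! i" if "i < k" for i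
    using ordered_partitions_block[OF assms that] by auto
  have len: "length Bs = k" using assms ordered_partitionsD(1) by blast
  show ?thesis
    unfolding append_singleton_def
  proof (rule ordered_partitionsI)
    have "(\<Union>i<k. (Bs @ [{Suc p}]) ! i) = (\<Union>i<k. Bs ! i)"
      by (rule SUP_cong) (use len in \<open>auto simp: nth_append\<close>)
    moreover have "(Bs @ [{Suc p}]) ! k = {Suc p}" using len by auto
    ultimately show "(\<Union>i<Suc k. (Bs @ [{Suc p}]) ! i) = {1..Suc p}"
      using ordered_partitionsD(2)[OF assms] by (auto simp: lessThan_Suc)
    show "(Bs @ [{Suc p}]) ! i \<noteq> {}" if "i < Suc k" for i
      using that len ordered_partitions_block(1)[OF assms] by (auto simp: nth_append)
    fix i j assume "i < j" "j < Suc k"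
    then show "(Bs @ [{Suc p}]) ! i \<inter> (Bs @ [{Suc p}]) ! j = {}"
      "Min ((Bs @ [{Suc p}]) ! i) < Min ((Bs @ [{Suc p}]) ! j)"
      using len sub Min ordered_partitionsD(3,4)[OF assms, of i j]
      by (auto simp: nth_append less_Suc_eq)
  qed (use len in simp)
qed

lemma insert_at_in_ordered_partitions:
  assumes "Bs \<in> ordered_partitions p k" "i < k"
  shows "insert_at (Suc p) (Bs, i) \<in> ordered_partitions (Suc p) k"
proof -
  let ?Cs = "Bs[i := insert (Suc p) (Bs ! i)]"
  have len: "length Bs = k" using assms ordered_partitionsD(1) by blast
  have Min: "Min (?Cs ! j) = Min (Bs ! j)" if "j < k" for j
    using ordered_partitions_block[OF assms(1) that] len that assms(2)
    by (cases "j = i") (auto simp: Min_insert_Suc simp del: Min_insert)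
  \<comment> \<open>Hence after insertion block i alone contains p+1, which keeps the blocks
    disjoint.\<close>
  have sub: "Suc p \<notin> Bs ! j" if "j < k" for j
    using ordered_partitions_block[OF assms(1) that] by auto
  have "(\<Union>j<k. ?Cs ! j) = insert (Suc p) (\<Union>j<k. Bs ! j)"
    using len assms(2) by (auto simp: nth_list_update split: if_splits)
  then have "(\<Union>j<k. ?Cs ! j) = {1..Suc p}"
    using ordered_partitionsD(2)[OF assms(1)] by auto
  moreover have "?Cs ! j \<inter> ?Cs ! l = {}" if "j < l" "l < k" for j l
  proof -
    have "Bs ! j \<inter> Bs ! l = {}" using ordered_partitionsD(3)[OF assms(1)] that by simp
    then show ?thesis using that len assms(2) sub[of j] sub[of l] by (simp add: nth_list_update)
  qed
  moreover have "?Cs ! j \<noteq> {}" if "j < k" for j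
    using ordered_partitions_block(1)[OF assms(1) that] that len assms(2)
    by (simp add: nth_list_update)
  ultimately show ?thesis
    using len Min ordered_partitionsD(4)[OF assms(1)] unfolding insert_at_def
    by (auto intro!: ordered_partitionsI)
qed

text \<open>Deleting p+1 from the unique block that contains it undoes one of the two extensions;
  which one depends on whether that block is {p+1}.\<close>

lemma ordered_partitions_Suc_cases:
  assumes "Cs \<in> ordered_partitions (Suc p) (Suc k)"
  shows "Cs \<in> append_singleton (Suc p) ` ordered_partitions p k
    \<union> insert_at (Suc p) ` (ordered_partitions p (Suc k) \<times> {..<Suc k})"
proof -
  have len: "length Cs = Suc k" and U: "(\<Union>i<Suc k. Cs ! i) = {1..Suc p}"
    and disj: "\<And>i j. i < j \<Longrightarrow> j < Suc k \<Longrightarrow> Cs ! i \<inter> Cs ! j = {}"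
    and Min: "\<And>i j. i < j \<Longrightarrow> j < Suc k \<Longrightarrow> Min (Cs ! i) < Min (Cs ! j)"
    by (fact ordered_partitionsD[OF assms])+
  note block = ordered_partitions_block[OF assms]
  have "Suc p \<in> (\<Union>i<Suc k. Cs ! i)"
    unfolding U by simp
  then obtain i where i: "i < Suc k" "Suc p \<in> Cs ! i"
    by blast
  have notin: "Suc p \<notin> Cs ! j" if "j < Suc k" "j \<noteq> i" for j
    using that i disj[of i j] disj[of j i] by (cases "i < j") auto
  show ?thesis
  proof (cases "Cs ! i = {Suc p}")
    case True
    \<comment> \<open>A block {p+1} before the last position would force the last minimum above
      p+1.\<close>
    have "i = k"
    proof (rule ccontr)
      assume "i \<noteq> k"
      with i have "Suc p < Min (Cs ! k)" using Min[of i k] True by simp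
      moreover have "Min (Cs ! k) \<le> Suc p"
        using block(4)[of k] by simp
      ultimately show False by simp
    qed
    then have Cs: "Cs = append_singleton (Suc p) (butlast Cs)"
      using len True unfolding append_singleton_def
      by (metis append_butlast_last_id diff_Suc_1 last_conv_nth length_0_conv nat.distinct(1))
    have nth: "butlast Cs ! j = Cs ! j" if "j < k" for j
      using that len by (simp add: nth_butlast)
    have "(\<Union>j<k. Cs ! j) = {1..p}"
    proof -
      have "(\<Union>j<k. Cs ! j) = (\<Union>j<Suc k. Cs ! j) - {Suc p}"
        using notin \<open>i = k\<close> True by (auto simp: less_Suc_eq)
      then show ?thesis unfolding U by auto
    qed
    then have "butlast Cs \<in> ordered_partitions p k"
      using len nth block(1) disj Min by (intro ordered_partitionsI) auto
    with Cs show ?thesis by blast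
  next
    case False
    let ?Bs = "Cs[i := Cs ! i - {Suc p}]"
    have ne: "Cs ! i - {Suc p} \<noteq> {}" using False i by auto
    have Cs: "Cs = insert_at (Suc p) (?Bs, i)"
      using i len by (simp add: insert_at_def insert_absorb)
    have fin: "finite (Cs ! i - {Suc p})" "Cs ! i - {Suc p} \<subseteq> {1..p}"
      using block(2,3)[OF i(1)] by (auto simp: le_Suc_eq dest: subsetD)
    \<comment> \<open>\<open>Min_insert_Suc\<close> is applied to the reduced block: putting p+1
      back does not change its minimum, so deleting p+1 did not either.\<close>
    have "Min (?Bs ! j) = Min (Cs ! j)" if "j < Suc k" for j
      using that i len Min_insert_Suc[OF fin(1) ne fin(2)]
      by (cases "j = i") (auto simp: insert_absorb)
    moreover have "(\<Union>j<Suc k. ?Bs ! j) = {1..p}"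
    proof -
      have "?Bs ! j = Cs ! j - {Suc p}" if "j < Suc k" for j
        using that notin[of j] len by (cases "j = i") auto
      then have "(\<Union>j<Suc k. ?Bs ! j) = (\<Union>j<Suc k. Cs ! j - {Suc p})"
        by (intro SUP_cong) auto
      also have "\<dots> = {1..Suc p} - {Suc p}"
        unfolding U[symmetric] by blast
      also have "\<dots> = {1..p}" by auto
      finally show ?thesis .
    qed
    moreover have "?Bs ! j \<inter> ?Bs ! l = {}" if "j < l" "l < Suc k" for j l
      using disj[OF that] that len i by (auto simp: nth_list_update)
    moreover have "?Bs ! j \<noteq> {}" if "j < Suc k" for j
      using that block(1) ne i len by (auto simp: nth_list_update)
    ultimately have "?Bs \<in> ordered_partitions p (Suc k)"
      using len Min by (intro ordered_partitionsI) auto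
    with Cs i show ?thesis by blast
  qed
qed

text \<open>The position is recovered as that of the block containing p+1, and the old list by
  removing p+1 from that block.\<close>

lemma inj_on_insert_at:
  "inj_on (insert_at (Suc p)) (ordered_partitions p k \<times> {..<k})"
proof (rule inj_onI, clarify)
  fix Bs i Cs j
  assume *: "Bs \<in> ordered_partitions p k" "Cs \<in> ordered_partitions p k" "i < k" "j < k"
    and eq: "insert_at (Suc p) (Bs, i) = insert_at (Suc p) (Cs, j)"
  have len: "length Bs = k" "length Cs = k" using * ordered_partitionsD(1) by blast+
  have notin: "Suc p \<notin> Bs ! l" "Suc p \<notin> Cs ! l" if "l < k" for l
    using ordered_partitions_block(2)[OF *(1) that] ordered_partitions_block(2)[OF *(2) that] by auto
  have nth: "Bs[i := insert (Suc p) (Bs ! i)] ! l = Cs[j := insert (Suc p) (Cs ! j)] ! l" for l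
    using eq by (simp add: insert_at_def)
  have "i = j"
  proof (rule ccontr)
    assume "i \<noteq> j"
    then have "insert (Suc p) (Bs ! i) = Cs ! i" using nth[of i] len * by simp
    then show False using notin * by blast
  qed
  moreover have "Bs ! l = Cs ! l" if "l < k" for l
    using nth[of l] notin[OF that] len * that \<open>i = j\<close>
    by (cases "l = i") (auto simp: insert_ident)
  ultimately show "Bs = Cs \<and> i = j"
    using len by (simp add: list_eq_iff_nth_eq)
qed

text \<open>The images of the two injective extensions are disjoint and cover everything. Values in
  a commutative monoid allow tensors as summands.\<close>

lemma sum_ordered_partitions_Suc:
  fixes F :: "nat set list \<Rightarrow> 'b::comm_monoid_add"
  shows "sum F (ordered_partitions (Suc p) (Suc k))
    = (\<Sum>Bs\<in>ordered_partitions p k. F (Bs @ [{Suc p}]))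
      + (\<Sum>Bs\<in>ordered_partitions p (Suc k). \<Sum>i<Suc k. F (Bs[i := insert (Suc p) (Bs ! i)]))"
proof -
  let ?S = "append_singleton (Suc p) ` ordered_partitions p k"
  let ?T = "insert_at (Suc p) ` (ordered_partitions p (Suc k) \<times> {..<Suc k})"
  have "ordered_partitions (Suc p) (Suc k) = ?S \<union> ?T"
  proof (rule antisym)
    show "ordered_partitions (Suc p) (Suc k) \<subseteq> ?S \<union> ?T"
      using ordered_partitions_Suc_cases by (rule subsetI)
    show "?S \<union> ?T \<subseteq> ordered_partitions (Suc p) (Suc k)"
      by (auto intro: append_singleton_in_ordered_partitions insert_at_in_ordered_partitions)
  qed
  moreover have "?S \<inter> ?T = {}"
  proof -
    have False if "Bs \<in> ordered_partitions p k" "Cs \<in> ordered_partitions p (Suc k)" "i < Suc k"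
      "append_singleton (Suc p) Bs = insert_at (Suc p) (Cs, i)" for Bs Cs i
    proof -
      have len: "length Bs = k" "length Cs = Suc k"
        using that(1,2) ordered_partitionsD(1) by blast+
      \<comment> \<open>Compare last blocks: insertion only enlarges blocks, so the non-empty
        \<open>Cs ! k\<close> within {1..p} would lie inside {p+1}. This treats i = k and i < k at
        once.\<close>
      have "{Suc p} = append_singleton (Suc p) Bs ! k"
        using len by (auto simp: append_singleton_def)
      also have "\<dots> \<supseteq> Cs ! k"
        using that(3,4) len by (auto simp: insert_at_def nth_list_update)
      finally show False
        using ordered_partitions_block(1,2)[OF that(2), of k] by auto
    qed
    then show ?thesis by blast
  qed
  ultimately have "sum F (ordered_partitions (Suc p) (Suc k)) = sum F ?S + sum F ?T"
    by (simp add: sum.union_disjoint finite_ordered_partitions)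
  also have "sum F ?S = (\<Sum>Bs\<in>ordered_partitions p k. F (Bs @ [{Suc p}]))"
    by (subst sum.reindex) (auto simp: append_singleton_def inj_on_def)
  also have "sum F ?T
      = (\<Sum>Bs\<in>ordered_partitions p (Suc k). \<Sum>i<Suc k. F (Bs[i := insert (Suc p) (Bs ! i)]))"
    by (subst sum.reindex[OF inj_on_insert_at])
      (simp add: insert_at_def sum.cartesian_product case_prod_unfold comp_def del: sum.lessThan_Suc)
  finally show ?thesis .
qed

subsection \<open>Blocks\<close>

lemma block_field_singleton: "block_field D X {n} = X n"
  by (simp add: block_field_def)

text \<open>As p+1 exceeds every element of \<open>B\<close>, it comes last in the sorted list and
  gives the outermost derivative; the start field is unchanged because \<open>B\<close> is
  non-empty.\<close>

lemma block_field_insert_Suc: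
  assumes "finite B" "B \<noteq> {}" "B \<subseteq> {1..p}"
  shows "block_field D X (insert (Suc p) B) = D (X (Suc p)) (block_field D X B)"
proof -
  have "sorted_list_of_set (insert (Suc p) B) = sorted_list_of_set B @ [Suc p]"
  proof (subst sorted_list_of_set_unique[symmetric])
    have "b < Suc p" if "b \<in> B" for b using assms(3) that by auto
    then show "sorted_wrt (<) (sorted_list_of_set B @ [Suc p]) \<and>
        set (sorted_list_of_set B @ [Suc p]) = insert (Suc p) B \<and>
        length (sorted_list_of_set B @ [Suc p]) = card (insert (Suc p) B)"
      using assms(1) by (auto simp: sorted_wrt_append card_insert_if)
  qed (use assms(1) in simp)
  moreover have "sorted_list_of_set B \<noteq> []" using assms by simp
  ultimately show ?thesis by (simp add: block_field_def Let_def)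
qed

lemma block_field_in_vector_fields:
  assumes "affine_connection M D" "\<forall>i\<in>B. X i \<in> vector_fields M" "finite B" "B \<noteq> {}"
  shows "block_field D X B \<in> vector_fields M"
proof -
  \<comment> \<open>The start field is generalized since \<open>fold\<close> replaces it at every
    step.\<close>
  have *: "fold (\<lambda>b Z. D (X b) Z) bs Z \<in> vector_fields M"
    if "set bs \<subseteq> B" "Z \<in> vector_fields M" for bs Z
    using that
    by (induction bs arbitrary: Z) (use assms(1,2) in \<open>auto simp: affine_connection_def\<close>)
  have "sorted_list_of_set B \<noteq> []" "set (sorted_list_of_set B) = B" using assms by auto
  then show ?thesis unfolding block_field_def Let_def
    by (intro *) (use assms(2) in \<open>auto dest: list.set_sel\<close>)
qed

section \<open>Induction on the number of derivatives\<close>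

theorem theorem4p2:
  fixes M :: "'a manifold" and g :: "'a metric_field" and D :: "'a connection"
    and A :: "'a tensor" and X :: "nat \<Rightarrow> 'a vfield" and p r s :: nat
  assumes "riemannian_manifold M g"
    and "levi_civita M g D"
    and "p \<ge> 1"
    and "A \<in> tensor_fields M r s"
    and "\<forall>i\<in>{1..p}. X i \<in> vector_fields M"
  shows "fold (\<lambda>i T. cov_tensor M D (X i) T) [1..<Suc p] A
       = (\<Sum>k=1..p. \<Sum>Bs\<in>ordered_partitions p k. iter_cov M D k A (map (block_field D X) Bs))"
proof -
  have M: "smooth_manifold M" and D: "affine_connection M D" and A: "smooth_valued M A"
    using assms smooth_valued_tensor_field by (auto simp: riemannian_manifold_def levi_civita_def)
  define F where "F k Bs = iter_cov M D k A (map (block_field D X) Bs)" for k Bs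
  have F_smooth: "smooth_valued M (F k Bs)"
    if "Bs \<in> ordered_partitions n k" "\<forall>i\<in>{1..n}. X i \<in> vector_fields M" for n k Bs
    unfolding F_def
  proof (rule smooth_valued_iter_cov[OF M D A])
    show "length (map (block_field D X) Bs) = k"
      using that by (simp add: ordered_partitions_iff_nth)
    have "block_field D X (Bs ! i) \<in> vector_fields M" if "i < k" for i
      using ordered_partitions_block[OF \<open>Bs \<in> _\<close> that] \<open>\<forall>i\<in>{1..n}. _\<close>
      by (intro block_field_in_vector_fields[OF D]) auto
    then show "set (map (block_field D X) Bs) \<subseteq> vector_fields M"
      using that(1) by (auto simp: ordered_partitions_iff_nth in_set_conv_nth)
  qed
  \<comment> \<open>The product rule in combinatorial form: the appended direction is the field of
    the block {n+1}, and differentiating argument i amounts to inserting n+1 into block i.\<close>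
  have step: "cov_tensor M D (X (Suc n)) (F k Bs) = F (Suc k) (Bs @ [{Suc n}])
      + (\<Sum>i<k. F k (Bs[i := insert (Suc n) (Bs ! i)]))"
    if "Bs \<in> ordered_partitions n k" for n k Bs
  proof -
    have len: "length Bs = k" using that ordered_partitionsD(1) by blast
    have "F k (Bs[i := insert (Suc n) (Bs ! i)]) = iter_cov M D k A
        ((map (block_field D X) Bs)[i := D (X (Suc n)) (map (block_field D X) Bs ! i)])"
      if "i < k" for i
      using ordered_partitions_block[OF \<open>Bs \<in> _\<close> that] len that
      by (simp add: F_def map_update block_field_insert_Suc)
    then show ?thesis
      using cov_tensor_iter_cov[of "map (block_field D X) Bs" k M D "X (Suc n)" A] len
      by (simp add: F_def block_field_singleton del: iter_cov.simps)
  qed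
  \<comment> \<open>Including k = 0 makes the formula valid at n = 0, where the empty partition
    contributes A itself.\<close>
  have "fold (\<lambda>i T. cov_tensor M D (X i) T) [1..<Suc n] A
      = (\<Sum>k\<le>n. \<Sum>Bs\<in>ordered_partitions n k. F k Bs)"
    if "\<forall>i\<in>{1..n}. X i \<in> vector_fields M" for n
    using that
  proof (induction n)
    case 0
    then show ?case by (simp add: ordered_partitions_0_0 F_def)
  next
    case (Suc n)
    let ?G = "\<lambda>k. \<Sum>Bs\<in>ordered_partitions n k. \<Sum>i<k. F k (Bs[i := insert (Suc n) (Bs ! i)])"
    have X: "X (Suc n) \<in> vector_fields M" "\<forall>i\<in>{1..n}. X i \<in> vector_fields M"
      using Suc.prems by auto
    have "fold (\<lambda>i T. cov_tensor M D (X i) T) [1..<Suc (Suc n)] A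
        = cov_tensor M D (X (Suc n)) (\<Sum>k\<le>n. \<Sum>Bs\<in>ordered_partitions n k. F k Bs)"
      using Suc.IH[OF X(2)] by simp
    \<comment> \<open>The derivative passes through both sums because \<open>F_smooth\<close> makes
      the inner sums smooth valued too.\<close>
    also have "\<dots> = (\<Sum>k\<le>n. \<Sum>Bs\<in>ordered_partitions n k. cov_tensor M D (X (Suc n)) (F k Bs))"
      using F_smooth X
      by (simp add: cov_tensor_sum[OF M X(1)] smooth_valued_sum[OF M])
    also have "\<dots> = (\<Sum>k\<le>n. \<Sum>Bs\<in>ordered_partitions n k. F (Suc k) (Bs @ [{Suc n}])) + (\<Sum>k\<le>n. ?G k)"
      by (simp add: step sum.distrib)
    \<comment> \<open>The added term is 0: n elements cannot form n+1 blocks.\<close>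
    also have "(\<Sum>k\<le>n. ?G k) = (\<Sum>k\<le>Suc n. ?G k)"
      by (simp add: ordered_partitions_eq_empty)
    \<comment> \<open>The term k = 0 vanishes because its sum over i < 0 is empty, also at n = 0
      where a partition into no blocks exists.\<close>
    also have "\<dots> = (\<Sum>k\<le>n. ?G (Suc k))"
      by (subst sum.atMost_Suc_shift) simp
    also have "(\<Sum>k\<le>n. \<Sum>Bs\<in>ordered_partitions n k. F (Suc k) (Bs @ [{Suc n}])) + (\<Sum>k\<le>n. ?G (Suc k))
        = (\<Sum>k\<le>n. sum (F (Suc k)) (ordered_partitions (Suc n) (Suc k)))"
      by (simp only: sum_ordered_partitions_Suc sum.distrib)
    \<comment> \<open>Here the restored term k = 0 is 0, as {1..n+1} has no partition into no
      blocks.\<close>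
    also have "\<dots> = (\<Sum>k\<le>Suc n. sum (F k) (ordered_partitions (Suc n) k))"
      unfolding sum.atMost_Suc_shift by (simp add: ordered_partitions_Suc_0)
    finally show ?case .
  qed
  from this[OF assms(5)]
  have "fold (\<lambda>i T. cov_tensor M D (X i) T) [1..<Suc p] A
      = (\<Sum>k\<le>p. \<Sum>Bs\<in>ordered_partitions p k. F k Bs)" .
  \<comment> \<open>Since p is at least 1, the term k = 0 is an empty sum and drops out.\<close>
  also have "\<dots> = (\<Sum>k=1..p. \<Sum>Bs\<in>ordered_partitions p k. F k Bs)"
    using \<open>p \<ge> 1\<close> ordered_partitions_Suc_0[of "p - 1"]
    by (intro sum.mono_neutral_right) (auto simp: not_less_eq_eq)
  finally show ?thesis by (simp only: F_def)
qed

end
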